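(* Suppose that $\kappa$ is a strongly inaccessible cardinal, and there exists a sequence $\langle A_\alpha\mid\alpha\in S\rangle$ such that: $S$ is a nonreflecting stationary subset of $\{\alpha<\kappa\mid\mathrm{cf}(\alpha)>\omega\}$; for every $\alpha\in S$, $A_\alpha$ is a cofinal subset of $\alpha$; and for every cofinal $B\subseteq\kappa$ there exists $\alpha\in S$ for which $\{\delta<\alpha\mid\min(A_\alpha\setminus(\delta+1))\in B\}$ is stationary in $\alpha$. Then $\mathrm P^-(\kappa,\kappa,{}^S{\sqsubseteq},1,\{S\},2)$ holds.
   Context: $S\subseteq\kappa$ is nonreflecting if there is no $\alpha<\kappa$ of uncountable cofinality with $S\cap\alpha$ stationary in $\alpha$. Notation: $\mathrm{acc}(C):=\{\alpha\in C\mid\sup(C\cap\alpha)=\alpha>0\}$; $C(j)$ is the $j$-th element of $C$; $\mathrm{succ}_n(C):=\{C(j+1)\mid j<n,\ j+1<\mathrm{otp}(C)\}$; $\mathrm{acc}(\kappa)$ is the set of nonzero limit ordinals below $\kappa$. $\mathcal K(\kappa)$ is the set of nonempty $x\subseteq\kappa$ club in $\sup(x)$ with $\sup(x)\notin x$; $\alpha_C:=\sup(C)$; $C\,{}^S{\sqsubseteq}\,D$ iff $C=D\cap\alpha_C$ and $\alpha_C\notin S$. $\mathrm P^-(\kappa,\kappa,{}^S{\sqsubseteq},1,\{S\},2)$ asserts the existence of $\langle\mathcal C_\alpha\mid\alpha<\kappa\rangle$ such that for every $\alpha\in\mathrm{acc}(\kappa)$: $\mathcal C_\alpha\subseteq\{C\in\mathcal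 K(\kappa)\mid\alpha_C=\alpha\}$, $0<|\mathcal C_\alpha|<\kappa$, and for all $C\in\mathcal C_\alpha$ and $\bar\alpha\in\mathrm{acc}(C)$ there is $D\in\mathcal C_{\bar\alpha}$ with $D\,{}^S{\sqsubseteq}\,C$; and for every cofinal $B\subseteq\kappa$ and every $n<\omega$, there are stationarily many $\alpha\in S$ with $|\mathcal C_\alpha|=1$ such that for the $C\in\mathcal C_\alpha$, $\sup\{\gamma\in C\mid\mathrm{succ}_n(C\setminus\gamma)\subseteq B\}=\alpha$ (one sequence working for all $n<\omega$). *)

theory Defs
  imports Main "HOL-Library.Infinite_Set"
begin

unbundle cardinal_syntax

text \<open>
  A type \<open>'k\<close> of class \<open>wellorder\<close> plays the role of the ordinal \<open>\<kappa>\<close>: its elements are the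
  ordinals below \<open>\<kappa>\<close>. Wherever an ordinal is used as a set, or may be equal to \<open>\<kappa>\<close>, it is
  represented in von Neumann style by an initial segment of \<open>'k\<close>: \<open>\<alpha> < \<kappa>\<close> by \<open>{..<\<alpha>}\<close>,
  \<open>\<alpha> + 1\<close> by \<open>{..\<alpha>}\<close>, \<open>\<kappa>\<close> by \<open>UNIV\<close> and \<open>0\<close> by \<open>{}\<close>. Accordingly, an ordinal \<open>\<delta>\<close> given as
  an initial segment belongs to a set \<open>X\<close> of ordinals iff \<open>\<delta> \<in> lessThan ` X\<close>.
\<close>

definition osup :: "'k::wellorder set \<Rightarrow> 'k set" where
  "osup X = (\<Union>\<xi>\<in>X. {..<\<xi>})"

text \<open>Order types are represented by well-orders, compared by the library's \<open><o\<close>.\<close>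

definition otp :: "'k::wellorder set \<Rightarrow> 'k rel" where
  "otp X = relation_of (\<le>) X"

definition strongly_inaccessible :: "'a rel \<Rightarrow> bool" where
  "strongly_inaccessible r \<longleftrightarrow>
     Card_order r \<and> natLeq <o r \<and> regularCard r \<and>
     (\<forall>A \<subseteq> Field r. |A| <o r \<longrightarrow> |Pow A| <o r)"

definition acc :: "'k::wellorder set \<Rightarrow> 'k set" where
  "acc C = {\<alpha> \<in> C. osup (C \<inter> {..<\<alpha>}) = {..<\<alpha>} \<and> {..<\<alpha>} \<noteq> {}}"

text \<open>In the next three definitions \<open>\<delta>\<close> is an ordinal \<open>\<le> \<kappa>\<close> given as an initial segment.\<close>

definition cofinal_in :: "'k::wellorder set \<Rightarrow> 'k set \<Rightarrow> bool" where
  "cofinal_in A \<delta> \<longleftrightarrow> A \<subseteq> \<delta> \<and> (\<forall>\<xi>\<in>\<delta>. \<exists>\<eta>\<in>A. \<xi> \<le> \<eta>)"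

definition club_in :: "'k::wellorder set \<Rightarrow> 'k set \<Rightarrow> bool" where
  "club_in C \<delta> \<longleftrightarrow>
     cofinal_in C \<delta> \<and>
     (\<forall>\<beta>\<in>\<delta>. osup (C \<inter> {..<\<beta>}) = {..<\<beta>} \<and> {..<\<beta>} \<noteq> {} \<longrightarrow> \<beta> \<in> C)"

definition stationary_in :: "'k::wellorder set \<Rightarrow> 'k set \<Rightarrow> bool" where
  "stationary_in T \<delta> \<longleftrightarrow> T \<subseteq> \<delta> \<and> (\<forall>C. club_in C \<delta> \<longrightarrow> T \<inter> C \<noteq> {})"

definition cf :: "'k::wellorder \<Rightarrow> 'k" where
  "cf \<alpha> = (LEAST \<beta>. \<exists>f. cofinal_in (f ` {..<\<beta>}) {..<\<alpha>})"

text \<open>The ordinal \<open>\<omega>\<close> as an element of \<open>\<kappa>\<close>; meaningful when \<open>\<kappa> > \<omega>\<close>.\<close>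

definition omega :: "'k::wellorder" where
  "omega = (LEAST \<alpha>. infinite {..<\<alpha>})"

definition nonreflecting :: "'k::wellorder set \<Rightarrow> bool" where
  "nonreflecting S \<longleftrightarrow> \<not> (\<exists>\<alpha>. omega < cf \<alpha> \<and> stationary_in (S \<inter> {..<\<alpha>}) {..<\<alpha>})"

text \<open>
  \<open>enumerate C j\<close> is \<open>C(j)\<close> for finite \<open>j < otp(C)\<close>; \<open>natLeq_on m\<close> is the ordinal \<open>m < \<omega>\<close>.
\<close>

definition succ_n :: "nat \<Rightarrow> 'k::wellorder set \<Rightarrow> 'k set" where
  "succ_n n C = {enumerate C (j + 1) | j. j < n \<and> natLeq_on (j + 1) <o otp C}"

definition K_set :: "'k::wellorder set set" where
  "K_set = {x. x \<noteq> {} \<and> club_in x (osup x) \<and> osup x \<notin> lessThan ` x}"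

definition S_end_ext :: "'k::wellorder set \<Rightarrow> 'k set \<Rightarrow> 'k set \<Rightarrow> bool" where
  "S_end_ext S C D \<longleftrightarrow> C = D \<inter> osup C \<and> osup C \<notin> lessThan ` S"

text \<open>The principle \<open>P\<^sup>-(\<kappa>, \<kappa>, \<^sup>S\<sqsubseteq>, 1, {S}, 2)\<close>.\<close>

definition P_minus :: "'k::wellorder set \<Rightarrow> bool" where
  "P_minus S \<longleftrightarrow>
     (\<exists>\<C> :: 'k \<Rightarrow> 'k set set.
        (\<forall>\<alpha> \<in> acc UNIV.
           \<C> \<alpha> \<subseteq> {C \<in> K_set. osup C = {..<\<alpha>}} \<and>
           \<C> \<alpha> \<noteq> {} \<and> |\<C> \<alpha>| <o otp (UNIV :: 'k set) \<and>
           (\<forall>C \<in> \<C> \<alpha>. \<forall>\<beta> \<in> acc C. \<exists>D \<in> \<C> \<beta>. S_end_ext S D C)) \<and>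
        (\<forall>B. cofinal_in B UNIV \<longrightarrow>
           (\<forall>n :: nat.
              stationary_in
                {\<alpha> \<in> S. card (\<C> \<alpha>) = 1 \<and>
                   (\<forall>C \<in> \<C> \<alpha>. osup {\<gamma> \<in> C. succ_n n (C - {..<\<gamma>}) \<subseteq> B} = {..<\<alpha>})}
                UNIV)))"

end

theory Submission
  imports Defs "HOL-Library.Countable_Set"
begin

text \<open>
  For \<open>\<alpha> \<notin> S\<close> let \<open>\<C> \<alpha>\<close> consist of all clubs in \<open>\<alpha>\<close> with no accumulation point in \<open>S\<close>: there are
  fewer than \<open>\<kappa>\<close> of them since \<open>\<kappa>\<close> is a strong limit, and at least one since \<open>S\<close> does not reflect.
  Coherence is then automatic, also for any singleton \<open>\<C> \<alpha>\<close>, \<open>\<alpha> \<in> S\<close>, of such a club.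

  For \<open>\<alpha> \<in> S\<close> take a club \<open>E\<close> in \<open>\<alpha>\<close> that is disjoint from \<open>S\<close> and consists of limits of \<open>A \<alpha>\<close>.
  Fix \<open>g\<close> listing each finite subset of \<open>\<kappa>\<close> cofinally often, and insert after each \<open>\<delta> \<in> E\<close>, below
  the next element of \<open>E\<close>, the elements of \<open>g (min (A \<alpha> - (\<delta> + 1)))\<close>. Finite blocks create no new
  accumulation points. Given \<open>B\<close>, \<open>n\<close> and a club \<open>K\<close>, let \<open>h \<epsilon>\<close> code an \<open>n\<close>-element subset of \<open>B\<close>
  above \<open>\<epsilon>\<close>, with an element of \<open>K\<close> between \<open>\<epsilon>\<close> and \<open>h \<epsilon>\<close>, and apply the hypothesis to \<open>h ` D\<close>, where
  \<open>D\<close> is the club of closure points of \<open>h\<close>. If \<open>\<delta> \<in> D\<close> and \<open>\<delta> < h \<epsilon>\<close>, then \<open>\<delta> \<le> \<epsilon>\<close>, so that the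
  block coded by \<open>h \<epsilon>\<close> lies above \<open>\<delta>\<close>.
\<close>

section \<open>Limit points, and clubs in ordinals of uncountable cofinality\<close>

text \<open>Holds vacuously at 0, hence the recurring side condition
  \<open>{..<\<beta>} \<noteq> {}\<close>; \<open>limit_of UNIV \<beta>\<close> says that \<beta> is
  0 or a limit ordinal.\<close>

definition limit_of :: "'k::wellorder set \<Rightarrow> 'k \<Rightarrow> bool" where
  "limit_of X \<beta> \<longleftrightarrow> (\<forall>\<zeta><\<beta>. \<exists>x\<in>X. \<zeta> < x \<and> x < \<beta>)"

lemma osup_Int_lessThan_iff: "osup (X \<inter> {..<\<beta>}) = {..<\<beta>} \<longleftrightarrow> limit_of X \<beta>"
  unfolding osup_def limit_of_def by (auto simp: set_eq_iff)

lemma acc_iff: "\<alpha> \<in> acc C \<longleftrightarrow> \<alpha> \<in> C \<and> limit_of C \<alpha> \<and> {..<\<alpha>} \<noteq> {}"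
  unfolding acc_def osup_Int_lessThan_iff by simp

lemma club_in_iff:
  "club_in C \<delta> \<longleftrightarrow> cofinal_in C \<delta> \<and> (\<forall>\<beta>\<in>\<delta>. limit_of C \<beta> \<and> {..<\<beta>} \<noteq> {} \<longrightarrow> \<beta> \<in> C)"
  unfolding club_in_def osup_Int_lessThan_iff by simp

lemma limit_of_mono: "limit_of X \<beta> \<Longrightarrow> X \<inter> {..<\<beta>} \<subseteq> Y \<Longrightarrow> limit_of Y \<beta>"
  unfolding limit_of_def by (meson IntI lessThan_iff subsetD)

text \<open>A largest element of the intersection would be exceeded within it. This is why finite
  blocks cannot create limit points.\<close>

lemma limit_of_infinite:
  assumes "limit_of X \<beta>" "\<xi> < \<beta>"
  shows "infinite (X \<inter> {\<xi><..<\<beta>})"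
proof
  assume fin: "finite (X \<inter> {\<xi><..<\<beta>})"
  obtain x where "x \<in> X" "\<xi> < x" "x < \<beta>"
    using assms unfolding limit_of_def by blast
  then have ne: "X \<inter> {\<xi><..<\<beta>} \<noteq> {}" by auto
  define m where "m = Max (X \<inter> {\<xi><..<\<beta>})"
  have m: "m \<in> X \<inter> {\<xi><..<\<beta>}" using Max_in[OF fin ne] m_def by simp
  then obtain y where y: "y \<in> X" "m < y" "y < \<beta>"
    using assms unfolding limit_of_def by auto
  with m have "y \<in> X \<inter> {\<xi><..<\<beta>}" by auto
  from Max_ge[OF fin this] y m_def show False by simp
qed

text \<open>\<open>cofinal_in\<close> asks only for a weak inequality, which a maximum would satisfy
  at a successor; the limit hypothesis supplies strictness.\<close>

lemma limit_of_cofinal: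
  assumes "cofinal_in X {..<\<alpha>}" "limit_of UNIV \<alpha>"
  shows "limit_of X \<alpha>"
  unfolding limit_of_def
proof (intro allI impI)
  fix \<zeta> assume "\<zeta> < \<alpha>"
  then obtain y where "\<zeta> < y" "y < \<alpha>" using assms(2) unfolding limit_of_def by blast
  then show "\<exists>x\<in>X. \<zeta> < x \<and> x < \<alpha>"
    using assms(1) unfolding cofinal_in_def by (meson lessThan_iff less_le_trans subsetD)
qed

text \<open>Expresses uncountable cofinality in a form that also applies to \<kappa> itself, which
  is not an argument of \<open>cf\<close>. Taking X empty excludes 0.\<close>

definition countably_closed :: "'k::wellorder set \<Rightarrow> bool" where
  "countably_closed \<delta> \<longleftrightarrow>
     (\<forall>\<beta>\<in>\<delta>. {..<\<beta>} \<subseteq> \<delta>) \<and> (\<forall>X\<subseteq>\<delta>. countable X \<longrightarrow> (\<exists>\<beta>\<in>\<delta>. \<forall>x\<in>X. x < \<beta>))"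

text \<open>The point y is the supremum of x, f x, f (f x), and so on. Suitable choices of f make y
  a limit of prescribed sets or a closure point.\<close>

lemma countably_closed_orbit_limit:
  assumes \<delta>: "countably_closed \<delta>" and f: "\<And>x. x \<in> \<delta> \<Longrightarrow> f x \<in> \<delta> \<and> x < f x" and x: "x \<in> \<delta>"
  obtains y where "y \<in> \<delta>" "x < y" "\<And>\<zeta>. \<zeta> < y \<Longrightarrow> \<exists>z. \<zeta> < z \<and> z \<in> \<delta> \<and> f z < y"
proof -
  define s where "s n = (f ^^ n) x" for n
  have s: "s n \<in> \<delta>" for n
    by (induction n) (auto simp: s_def x f)
  have step: "s n < s (Suc n)" for n
    using f[OF s[of n]] by (simp add: s_def)
  have "\<exists>\<beta>\<in>\<delta>. \<forall>x\<in>range s. x < \<beta>"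
    using \<delta> s unfolding countably_closed_def by (metis countable_image countableI_type image_subsetI)
  then obtain b where b: "b \<in> \<delta>" "\<And>n. s n < b" by auto
  define y where "y = (LEAST y. \<forall>n. s n < y)"
  have y: "s n < y" for n
    unfolding y_def using LeastI[of "\<lambda>y. \<forall>n. s n < y" b] b by blast
  have yb: "y \<le> b" unfolding y_def by (rule Least_le) (use b in blast)
  have y\<delta>: "y \<in> \<delta>" using yb b \<delta> unfolding countably_closed_def
    by (metis lessThan_iff order_le_less subsetD)
  have "\<exists>z. \<zeta> < z \<and> z \<in> \<delta> \<and> f z < y" if "\<zeta> < y" for \<zeta>
  proof -
    have "\<not> (\<forall>n. s n < \<zeta>)" using not_less_Least that unfolding y_def by blast
    then obtain n where "\<zeta> \<le> s n" by (auto simp: not_less)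
    \<comment> \<open>The bound by \<open>s n\<close> is only weak, so the next iterate serves as
      z.\<close>
    then have "\<zeta> < s (Suc n)" using step by (meson le_less_trans)
    moreover have "f (s (Suc n)) < y" using y[of "Suc (Suc n)"] by (simp add: s_def)
    ultimately show ?thesis using s by blast
  qed
  moreover have "x < y" using y[of 0] by (simp add: s_def)
  ultimately show ?thesis using that y\<delta> by blast
qed

lemma cofinal_in_above:
  assumes "countably_closed \<delta>" "cofinal_in C \<delta>" "x \<in> \<delta>"
  obtains c where "c \<in> C" "c \<in> \<delta>" "x < c"
proof -
  have "\<exists>\<beta>\<in>\<delta>. \<forall>z\<in>{x}. z < \<beta>"
    using assms(1,3) unfolding countably_closed_def
    by (meson countable_finite empty_subsetI finite.intros insert_subset)
  then obtain \<beta> where "\<beta> \<in> \<delta>" "x < \<beta>" by auto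
  then show ?thesis using assms(2) that unfolding cofinal_in_def
    by (meson less_le_trans subsetD)
qed

text \<open>An orbit alternating between C and D has a supremum that is a limit of both sets, hence
  lies in both.\<close>

lemma club_in_Int:
  assumes \<delta>: "countably_closed \<delta>" and C: "club_in C \<delta>" and D: "club_in D \<delta>"
  shows "club_in (C \<inter> D) \<delta>"
  unfolding club_in_iff
proof
  have "\<exists>c. c \<in> C \<and> c \<in> \<delta> \<and> x < c" if "x \<in> \<delta>" for x
    using cofinal_in_above[OF \<delta> _ that] C unfolding club_in_iff by metis
  then obtain c where c: "\<And>x. x \<in> \<delta> \<Longrightarrow> c x \<in> C \<and> c x \<in> \<delta> \<and> x < c x" by metis
  have "\<exists>c. c \<in> D \<and> c \<in> \<delta> \<and> x < c" if "x \<in> \<delta>" for x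
    using cofinal_in_above[OF \<delta> _ that] D unfolding club_in_iff by metis
  then obtain d where d: "\<And>x. x \<in> \<delta> \<Longrightarrow> d x \<in> D \<and> d x \<in> \<delta> \<and> x < d x" by metis
  have "\<exists>y\<in>C \<inter> D. x \<le> y" if x: "x \<in> \<delta>" for x
  proof -
    have cd: "d (c z) \<in> \<delta> \<and> z < d (c z)" if "z \<in> \<delta>" for z
      using c d that by (meson order.strict_trans)
    obtain y where y: "y \<in> \<delta>" "x < y" "\<And>\<zeta>. \<zeta> < y \<Longrightarrow> \<exists>z. \<zeta> < z \<and> z \<in> \<delta> \<and> d (c z) < y"
      using countably_closed_orbit_limit[of \<delta> "\<lambda>z. d (c z)", OF \<delta> cd x] by blast
    have "limit_of C y" "limit_of D y"
      unfolding limit_of_def using y(3) c d by (meson order.strict_trans)+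
    moreover have "{..<y} \<noteq> {}" using y(2) by auto
    ultimately have "y \<in> C \<inter> D" using C D y(1) unfolding club_in_iff by blast
    then show ?thesis using y(2) by (meson less_imp_le)
  qed
  then show "cofinal_in (C \<inter> D) \<delta>"
    using C unfolding club_in_iff cofinal_in_def by blast
  show "\<forall>\<beta>\<in>\<delta>. limit_of (C \<inter> D) \<beta> \<and> {..<\<beta>} \<noteq> {} \<longrightarrow> \<beta> \<in> C \<inter> D"
    using C D limit_of_mono unfolding club_in_iff by (metis Int_iff inf_le1 inf_le2 le_infI1)
qed

text \<open>Iterating a choice of larger elements of A reaches a limit of A above any given point,
  and limits of limits are limits.\<close>

lemma club_in_limits:
  assumes \<delta>: "countably_closed \<delta>" and A: "cofinal_in A \<delta>"
  shows "club_in {\<beta>\<in>\<delta>. limit_of A \<beta>} \<delta>"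
  unfolding club_in_iff
proof
  have "\<exists>c. c \<in> A \<and> c \<in> \<delta> \<and> x < c" if "x \<in> \<delta>" for x
    using cofinal_in_above[OF \<delta> A that] by metis
  then obtain c where c: "\<And>x. x \<in> \<delta> \<Longrightarrow> c x \<in> A \<and> c x \<in> \<delta> \<and> x < c x" by metis
  have "\<exists>y\<in>{\<beta>\<in>\<delta>. limit_of A \<beta>}. x \<le> y" if x: "x \<in> \<delta>" for x
  proof -
    have c': "c z \<in> \<delta> \<and> z < c z" if "z \<in> \<delta>" for z
      using c that by blast
    obtain y where y: "y \<in> \<delta>" "x < y" "\<And>\<zeta>. \<zeta> < y \<Longrightarrow> \<exists>z. \<zeta> < z \<and> z \<in> \<delta> \<and> c z < y"
      using countably_closed_orbit_limit[of \<delta> c, OF \<delta> c' x] by blast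
    have "limit_of A y"
      unfolding limit_of_def using y(3) c by (meson order.strict_trans)
    then show ?thesis using y(1,2) by (auto intro: less_imp_le)
  qed
  then show "cofinal_in {\<beta>\<in>\<delta>. limit_of A \<beta>} \<delta>"
    unfolding cofinal_in_def by blast
  show "\<forall>\<beta>\<in>\<delta>. limit_of {\<beta>\<in>\<delta>. limit_of A \<beta>} \<beta> \<and> {..<\<beta>} \<noteq> {} \<longrightarrow> \<beta> \<in> {\<beta>\<in>\<delta>. limit_of A \<beta>}"
  proof (intro ballI impI)
    fix \<beta> assume "\<beta> \<in> \<delta>" and l: "limit_of {\<beta>\<in>\<delta>. limit_of A \<beta>} \<beta> \<and> {..<\<beta>} \<noteq> {}"
    have "limit_of A \<beta>" unfolding limit_of_def
    proof (intro allI impI)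
      fix \<zeta> assume "\<zeta> < \<beta>"
      then obtain x where "limit_of A x" "\<zeta> < x" "x < \<beta>" using l unfolding limit_of_def by blast
      then show "\<exists>x\<in>A. \<zeta> < x \<and> x < \<beta>" unfolding limit_of_def by (meson order.strict_trans)
    qed
    with \<open>\<beta> \<in> \<delta>\<close> show "\<beta> \<in> {\<beta>\<in>\<delta>. limit_of A \<beta>}" by simp
  qed
qed

lemma club_in_greaterThan:
  assumes "countably_closed \<delta>" "\<xi> \<in> \<delta>"
  shows "club_in {x\<in>\<delta>. \<xi> < x} \<delta>"
  unfolding club_in_iff
proof
  have cof: "cofinal_in \<delta> \<delta>" unfolding cofinal_in_def by auto
  have "\<exists>y\<in>{x\<in>\<delta>. \<xi> < x}. x \<le> y" if "x \<in> \<delta>" for x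
  proof -
    have "max x \<xi> \<in> \<delta>" using assms(2) that by (simp add: max_def)
    then obtain c where "c \<in> \<delta>" "max x \<xi> < c" using cofinal_in_above[OF assms(1) cof] by blast
    then show ?thesis by (auto intro!: bexI[of _ c])
  qed
  then show "cofinal_in {x\<in>\<delta>. \<xi> < x} \<delta>" unfolding cofinal_in_def by blast
  show "\<forall>\<beta>\<in>\<delta>. limit_of {x \<in> \<delta>. \<xi> < x} \<beta> \<and> {..<\<beta>} \<noteq> {} \<longrightarrow> \<beta> \<in> {x \<in> \<delta>. \<xi> < x}"
  proof (intro ballI impI)
    fix \<beta> assume \<beta>: "\<beta> \<in> \<delta>" "limit_of {x \<in> \<delta>. \<xi> < x} \<beta> \<and> {..<\<beta>} \<noteq> {}"
    then obtain \<zeta> where "\<zeta> < \<beta>" by auto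
    then obtain x where "\<xi> < x" "x < \<beta>" using \<beta>(2) unfolding limit_of_def by blast
    then show "\<beta> \<in> {x \<in> \<delta>. \<xi> < x}" using \<beta>(1) by auto
  qed
qed

section \<open>Enumeration of finite initial blocks, and coding of finite lists\<close>

text \<open>Since F lies below the rest of X, the least element of X is in F; removing it from both
  sets drives the induction. X may be finite, but j stays short of its end.\<close>

lemma enumerate_in_initial_part:
  fixes X :: "'k::wellorder set"
  assumes "finite F" "F \<subseteq> X" "\<And>x f. x \<in> X - F \<Longrightarrow> f \<in> F \<Longrightarrow> f < x" "j < card F"
  shows "enumerate X j \<in> F"
  using assms
proof (induction j arbitrary: X F)
  case (0 X F)
  then obtain f where f: "f \<in> F" by fastforce
  then have "(LEAST x. x \<in> X) \<in> X" using 0 by (metis LeastI subsetD)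
  moreover have "(LEAST x. x \<in> X) \<le> f" using f 0 by (intro Least_le) auto
  ultimately show ?case using 0(3)[of "LEAST x. x \<in> X" f] f
    by (metis Diff_iff enumerate_0 leD)
next
  case (Suc j X F)
  define m where "m = (LEAST x. x \<in> X)"
  obtain f where f: "f \<in> F" using Suc.prems by fastforce
  then have "m \<in> X" using Suc.prems unfolding m_def by (metis LeastI subsetD)
  moreover have "m \<le> f" unfolding m_def using f Suc.prems by (intro Least_le) auto
  ultimately have m: "m \<in> F" using Suc.prems(3)[of m f] f by (metis Diff_iff leD)
  have "enumerate (X - {m}) j \<in> F - {m}"
    by (rule Suc.IH) (use Suc.prems m in auto)
  then show ?case by (simp add: enumerate_Suc m_def)
qed

text \<open>A surjection p onto pairs can be iterated to unpack n entries from one point, and n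
  itself is read off another point through q. Lists, unlike sets, have a head that can later serve
  as a dummy entry.\<close>

lemma infinite_imp_surj_lists:
  assumes "infinite (UNIV :: 'a set)"
  shows "\<exists>d :: 'a \<Rightarrow> 'a list. surj d"
proof -
  have "|UNIV \<times> UNIV :: ('a \<times> 'a) set| =o |UNIV :: 'a set|"
    by (rule card_of_Times_same_infinite[OF assms])
  then obtain p :: "'a \<Rightarrow> 'a \<times> 'a" where p: "surj p"
    using card_of_ordIso ordIso_symmetric unfolding bij_betw_def by (metis UNIV_Times_UNIV)
  obtain i :: "nat \<Rightarrow> 'a" where "inj i"
    using infinite_countable_subset[OF assms] by blast
  then obtain q :: "'a \<Rightarrow> nat" where q: "surj q"
    by (metis inj_imp_surj_inv)
  define dec :: "nat \<Rightarrow> 'a \<Rightarrow> 'a list"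
    where "dec = rec_nat (\<lambda>x. []) (\<lambda>n f x. fst (p x) # f (snd (p x)))"
  have dec: "\<exists>x. dec (length l) x = l" for l
  proof (induction l)
    case (Cons a l)
    then obtain x where x: "dec (length l) x = l" by blast
    obtain y where "p y = (a, x)" using p by (metis surjD)
    with x have "dec (length (a # l)) y = a # l" by (simp add: dec_def)
    then show ?case by blast
  qed (simp add: dec_def)
  have "\<exists>x. l = dec (q (fst (p x))) (snd (p x))" for l
  proof -
    obtain x where x: "dec (length l) x = l" using dec by blast
    obtain a where a: "length l = q a" using q by (metis surjD)
    obtain y where "p y = (a, x)" using p by (metis surjD)
    with x a show ?thesis by (metis fst_conv snd_conv)
  qed
  then have "surj (\<lambda>x. dec (q (fst (p x))) (snd (p x)))" by (simp add: surj_def)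
  then show ?thesis by blast
qed

section \<open>Consequences of strong inaccessibility\<close>

lemma Field_otp_UNIV [simp]: "Field (otp (UNIV :: 'k::wellorder set)) = UNIV"
  unfolding otp_def Field_def relation_of_def by auto

lemma
  assumes "strongly_inaccessible (otp (UNIV :: 'k::wellorder set))"
  shows strongly_inaccessible_lessThan: "|{..<\<alpha>::'k}| <o otp (UNIV :: 'k set)"
    and strongly_inaccessible_infinite: "infinite (UNIV :: 'k set)"
    and strongly_inaccessible_bounded:
      "|X :: 'k set| <o otp (UNIV :: 'k set) \<Longrightarrow> \<exists>\<beta>. \<forall>x\<in>X. x < \<beta>"
    and strongly_inaccessible_countable: "countable (Y :: 'b set) \<Longrightarrow> |Y| <o otp (UNIV :: 'k set)"
proof -
  let ?r = "otp (UNIV :: 'k set)"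
  have co: "Card_order ?r" and nat: "natLeq <o ?r" and reg: "regularCard ?r"
    using assms unfolding strongly_inaccessible_def by auto
  have "underS ?r \<alpha> = {..<\<alpha>}" unfolding underS_def otp_def relation_of_def by auto
  then show "|{..<\<alpha>}| <o ?r" using card_of_underS[OF co, of \<alpha>] by simp
  show inf: "infinite (UNIV :: 'k set)"
    using nat co by (metis Field_otp_UNIV cinfinite_def cinfinite_mono natLeq_cinfinite ordLess_imp_ordLeq)
  show "\<exists>\<beta>. \<forall>x\<in>X. x < \<beta>" if X: "|X| <o ?r"
  proof -
    have "\<not> cofinal X ?r" using reg X not_ordLess_ordIso unfolding regularCard_def by auto
    then obtain a where a: "\<forall>b\<in>X. b \<le> a"
      unfolding cofinal_def by (auto simp: otp_def relation_of_def) (metis linear order_le_less)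
    \<comment> \<open>Failure of the strict notion \<open>cofinal\<close> gives only the weak bound
      a; an infinite cardinal has no greatest element, so a strict bound exists too.\<close>
    have "under ?r a \<noteq> UNIV"
      using Card_order_infinite_not_under[OF co] inf by auto
    then obtain \<beta> where "a < \<beta>" 
      by (auto simp: under_def otp_def relation_of_def) (meson not_le)
    then show ?thesis using a by (meson le_less_trans)
  qed
  show "|Y| <o ?r" if "countable Y"
  proof -
    have "|Y| \<le>o |UNIV :: nat set|" using that unfolding countable_def card_of_ordLeq[symmetric] by auto
    then show ?thesis using nat card_of_nat by (meson ordIso_ordLess_trans ordLeq_ordLess_trans)
  qed
qed

lemma countably_closed_UNIV:
  assumes "strongly_inaccessible (otp (UNIV :: 'k::wellorder set))"
  shows "countably_closed (UNIV :: 'k set)"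
  unfolding countably_closed_def
  using strongly_inaccessible_bounded[OF assms] strongly_inaccessible_countable[OF assms] by auto

text \<open>The head of a decoded list is ignored. If F had no code above \<epsilon>, then the codes
  of all lists \<open>a # l\<close> with \<open>set l = F\<close> would be bounded, and taking heads
  would map a proper initial segment onto \<kappa>.\<close>

lemma finite_sets_enumerated_cofinally:
  assumes si: "strongly_inaccessible (otp (UNIV :: 'k::wellorder set))"
  obtains g :: "'k::wellorder \<Rightarrow> 'k set"
  where "\<And>\<eta>. finite (g \<eta>)" "\<And>F \<epsilon>. finite F \<Longrightarrow> \<exists>\<eta>>\<epsilon>. g \<eta> = F"
proof -
  obtain d :: "'k \<Rightarrow> 'k list" where d: "surj d"
    using infinite_imp_surj_lists[OF strongly_inaccessible_infinite[OF si]] by blast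
  have "\<exists>\<eta>>\<epsilon>. set (tl (d \<eta>)) = F" if F: "finite F" for F \<epsilon>
  proof (rule ccontr)
    assume no: "\<not> (\<exists>\<eta>>\<epsilon>. set (tl (d \<eta>)) = F)"
    obtain l where l: "set l = F" using finite_list[OF F] by blast
    obtain \<beta> where \<beta>: "\<epsilon> < \<beta>"
      using strongly_inaccessible_bounded[OF si strongly_inaccessible_countable[OF si], of "{\<epsilon>}"] by auto
    have "UNIV \<subseteq> (\<lambda>\<eta>. hd (d \<eta>)) ` {..<\<beta>}"
    proof
      fix a :: 'k
      obtain \<eta> where \<eta>: "d \<eta> = a # l" using d by (metis surjD)
      then have "\<not> \<epsilon> < \<eta>" using no l by auto
      then have "\<eta> < \<beta>" using \<beta> by (meson le_less_trans not_le)
      then show "a \<in> (\<lambda>\<eta>. hd (d \<eta>)) ` {..<\<beta>}" using \<eta> by force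
    qed
    then have "|UNIV :: 'k set| \<le>o |{..<\<beta>}|" by (rule surj_imp_ordLeq)
    then have "|UNIV :: 'k set| <o otp (UNIV :: 'k set)"
      using strongly_inaccessible_lessThan[OF si] ordLeq_ordLess_trans by blast
    then show False using strongly_inaccessible_bounded[OF si, of UNIV] by blast
  qed
  then show ?thesis using that[of "\<lambda>\<eta>. set (tl (d \<eta>))"] by blast
qed

section \<open>Countable and uncountable cofinality\<close>

text \<open>A countably infinite set is bounded, so the minimum defining \<open>omega\<close> is
  attained; below it, initial segments are finite and are told apart by their cardinalities.\<close>

lemma
  assumes "strongly_inaccessible (otp (UNIV :: 'k::wellorder set))"
  shows infinite_lessThan_omega: "infinite {..<omega :: 'k}"
    and countable_lessThan_omega: "countable {..<omega :: 'k}"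
proof -
  obtain X :: "'k set" where X: "countable X" "infinite X"
    using infinite_countable_subset'[OF strongly_inaccessible_infinite[OF assms]] by blast
  obtain \<beta> where "\<forall>x\<in>X. x < \<beta>"
    using strongly_inaccessible_bounded[OF assms strongly_inaccessible_countable[OF assms X(1)]] by blast
  then have "X \<subseteq> {..<\<beta>}" by auto
  with X have "infinite {..<\<beta>}" using infinite_super by blast
  then show "infinite {..<omega :: 'k}" unfolding omega_def by (rule LeastI)
  have fin: "finite {..<x}" if "x < omega" for x :: 'k
    using not_less_Least that unfolding omega_def by blast
  have "card {..<x} < card {..<y}" if "y < omega" "x < y" for x y :: 'k
    using that fin by (intro psubset_card_mono) auto
  then have "inj_on (\<lambda>x. card {..<x}) {..<omega :: 'k}"
    unfolding inj_on_def by (metis lessThan_iff less_irrefl neqE)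
  then show "countable {..<omega :: 'k}" by (rule countableI)
qed

text \<open>A nonempty countable set is an image of \<open>{..<omega}\<close>, hence not cofinal
  when \<open>cf \<alpha>\<close> exceeds \<open>omega\<close>.\<close>

lemma countably_closed_of_cf:
  assumes si: "strongly_inaccessible (otp (UNIV :: 'k::wellorder set))" and \<alpha>: "omega < cf (\<alpha>::'k)"
  shows "countably_closed {..<\<alpha>}"
  unfolding countably_closed_def
proof (intro conjI ballI allI impI)
  fix X assume X: "X \<subseteq> {..<\<alpha>}" "countable X"
  have nof: "\<not> cofinal_in (f ` {..<omega}) {..<\<alpha>}" for f :: "'k \<Rightarrow> 'k"
    using not_less_Least \<alpha> unfolding cf_def by blast
  show "\<exists>\<beta>\<in>{..<\<alpha>}. \<forall>x\<in>X. x < \<beta>"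
  proof (cases "X = {}")
    case True
    \<comment> \<open>Any element bounds the empty set, so only \<alpha> = 0 must be excluded; there
      \<open>cf \<alpha>\<close> would be at most \<alpha>, hence at most
      \<open>omega\<close>.\<close>
    have "{..<\<alpha>} \<noteq> {}"
    proof
      assume e: "{..<\<alpha>} = {}"
      have "\<alpha> \<le> omega" using e by (metis empty_iff lessThan_iff not_le)
      moreover have "cf \<alpha> \<le> \<alpha>" unfolding cf_def
        by (rule Least_le) (use e in \<open>auto simp: cofinal_in_def\<close>)
      ultimately show False using \<alpha> by simp
    qed
    then show ?thesis using True by blast
  next
    case False
    then obtain e :: "nat \<Rightarrow> 'k" where e: "X = range e"
      using X by (metis range_from_nat_into)
    obtain i :: "nat \<Rightarrow> 'k" where i: "inj i" "range i \<subseteq> {..<omega}"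
      using infinite_countable_subset[OF infinite_lessThan_omega[OF si]] by blast
    have "(\<lambda>x. e (inv i x)) ` {..<omega} = X"
      using e i by (auto simp: image_iff) (metis inv_f_f lessThan_iff rangeI subsetD)
    then have "\<not> cofinal_in X {..<\<alpha>}" using nof by metis
    then show ?thesis using X unfolding cofinal_in_def by (meson not_le)
  qed
qed auto

text \<open>The identity shows that the minimum defining \<open>cf\<close> is attained, and here the
  domain of the witness is countable.\<close>

lemma countable_cofinal_of_cf:
  assumes si: "strongly_inaccessible (otp (UNIV :: 'k::wellorder set))" and \<alpha>: "\<not> omega < cf (\<alpha>::'k)"
  obtains X where "countable X" "cofinal_in X {..<\<alpha>}"
proof -
  have "\<exists>f. cofinal_in (f ` {..<\<alpha>}) {..<\<alpha>}"
    by (rule exI[of _ id]) (auto simp: cofinal_in_def)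
  then have "\<exists>f. cofinal_in (f ` {..<cf \<alpha>}) {..<\<alpha>}"
    unfolding cf_def by (rule LeastI)
  moreover have "{..<cf \<alpha>} \<subseteq> {..<omega}" using \<alpha> by auto
  then have "countable {..<cf \<alpha>}" using countable_lessThan_omega[OF si] countable_subset by blast
  ultimately show ?thesis using that by blast
qed

text \<open>A cofinal set of order type at most \<open>\<omega>\<close> is vacuously closed.\<close>

lemma club_without_limits:
  fixes \<alpha> :: "'k::wellorder"
  assumes "countable X" "cofinal_in X {..<\<alpha>}" and "{..<\<alpha>} \<noteq> {}"
  obtains C where "club_in C {..<\<alpha>}" "\<And>\<beta>. \<beta> < \<alpha> \<Longrightarrow> {..<\<beta>} \<noteq> {} \<Longrightarrow> \<not> limit_of C \<beta>"
proof -
  have "X \<noteq> {}" using assms unfolding cofinal_in_def by blast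
  then obtain e :: "nat \<Rightarrow> 'k" where e: "X = range e" using assms by (metis range_from_nat_into)
  \<comment> \<open>Running maxima make the enumeration of X nondecreasing, so that only finitely
    many values lie below any \<beta> < \<alpha>.\<close>
  define t where "t n = Max (e ` {..n})" for n
  have tX: "t n \<in> X" for n unfolding t_def e
    by (metis Max_in atMost_iff empty_iff finite_atMost finite_imageI image_is_empty image_mono le0 subsetD subset_UNIV)
  have et: "e m \<le> t n" if "m \<le> n" for m n unfolding t_def using that by simp
  have mono: "t m \<le> t n" if "m \<le> n" for m n
    unfolding t_def using that by (intro Max_mono) auto
  have fin: "finite (range t \<inter> {..<\<beta>})" if \<beta>: "\<beta> < \<alpha>" for \<beta>
  proof -
    obtain n where "\<beta> \<le> e n" using assms(2) \<beta> e unfolding cofinal_in_def by auto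
    then have \<beta>n: "\<beta> \<le> t n" using et[of n n] by simp
    have "m \<le> n" if "t m < \<beta>" for m
      using mono[of n m] \<beta>n that by (meson leD linear order_trans)
    then have "range t \<inter> {..<\<beta>} \<subseteq> t ` {..n}" by auto
    then show ?thesis using finite_subset by blast
  qed
  have nl: "\<not> limit_of (range t) \<beta>" if "\<beta> < \<alpha>" "{..<\<beta>} \<noteq> {}" for \<beta>
  proof
    assume l: "limit_of (range t) \<beta>"
    from \<open>{..<\<beta>} \<noteq> {}\<close> obtain \<xi> where \<xi>: "\<xi> < \<beta>" by auto
    have "finite (range t \<inter> {\<xi><..<\<beta>})"
      by (rule finite_subset[OF _ fin[OF \<open>\<beta> < \<alpha>\<close>]]) auto
    with limit_of_infinite[OF l \<xi>] show False by blast
  qed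
  moreover have "club_in (range t) {..<\<alpha>}"
    unfolding club_in_iff
  proof
    show "cofinal_in (range t) {..<\<alpha>}"
      unfolding cofinal_in_def
    proof
      show "range t \<subseteq> {..<\<alpha>}" using assms(2) tX unfolding cofinal_in_def by blast
      show "\<forall>\<xi>\<in>{..<\<alpha>}. \<exists>\<eta>\<in>range t. \<xi> \<le> \<eta>"
      proof
        fix \<xi> assume "\<xi> \<in> {..<\<alpha>}"
        then obtain n where "\<xi> \<le> e n" using assms(2) e unfolding cofinal_in_def by auto
        then have "\<xi> \<le> t n" using et[of n n] by simp
        then show "\<exists>\<eta>\<in>range t. \<xi> \<le> \<eta>" by blast
      qed
    qed
  qed (use nl in auto)
  ultimately show ?thesis using that by blast
qed

section \<open>Inserting finite blocks into a club\<close>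

text \<open>The elements of \<open>F \<delta>\<close> are inserted between \<open>\<delta>\<close> and its successor in \<open>E\<close>.\<close>

definition fill :: "'k::wellorder \<Rightarrow> 'k set \<Rightarrow> ('k \<Rightarrow> 'k set) \<Rightarrow> 'k set" where
  "fill \<alpha> E F = E \<union> {\<xi>. \<xi> < \<alpha> \<and> (\<exists>\<delta>\<in>E. \<delta> < \<xi> \<and> \<xi> \<in> F \<delta> \<and> {\<delta><..\<xi>} \<inter> E = {})}"

text \<open>If E had no point strictly between \<zeta> and \<beta>, all points of the filled set
  there would have been inserted after the same element of E, although there are infinitely many of
  them and each block is finite.\<close>

lemma limit_of_fill:
  assumes fin: "\<And>\<delta>. finite (F \<delta>)" and lim: "limit_of (fill \<alpha> E F) \<beta>"
  shows "limit_of E \<beta>"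
  unfolding limit_of_def
proof (intro allI impI, rule ccontr)
  fix \<zeta> assume \<zeta>: "\<zeta> < \<beta>" and no: "\<not> (\<exists>x\<in>E. \<zeta> < x \<and> x < \<beta>)"
  let ?X = "fill \<alpha> E F \<inter> {\<zeta><..<\<beta>}"
  have inf: "infinite ?X" using limit_of_infinite[OF lim \<zeta>] .
  have X: "\<exists>\<delta>\<in>E. \<delta> \<le> \<zeta> \<and> x \<in> F \<delta> \<and> {\<delta><..x} \<inter> E = {}" if "x \<in> ?X" for x
  proof -
    have x: "x \<notin> E" "\<zeta> < x" "x < \<beta>" "x \<in> fill \<alpha> E F" using that no by auto
    then obtain \<delta> where \<delta>: "\<delta> \<in> E" "\<delta> < x" "x \<in> F \<delta>" "{\<delta><..x} \<inter> E = {}"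
      unfolding fill_def by blast
    then have "\<delta> \<le> \<zeta>" using no x by (meson not_le order.strict_trans)
    with \<delta> show ?thesis by blast
  qed
  obtain x0 where "x0 \<in> ?X" using inf by (metis finite.emptyI ex_in_conv)
  then obtain \<delta>0 where \<delta>0: "\<delta>0 \<in> E" "\<delta>0 \<le> \<zeta>" "{\<delta>0<..x0} \<inter> E = {}" and x0: "\<zeta> < x0"
    using X by auto
  have "?X \<subseteq> F \<delta>0"
  proof
    fix x assume x: "x \<in> ?X"
    then obtain \<delta> where \<delta>: "\<delta> \<in> E" "\<delta> \<le> \<zeta>" "x \<in> F \<delta>" "{\<delta><..x} \<inter> E = {}" using X by blast
    have "\<zeta> < x" using x by simp
    \<comment> \<open>Of two distinct candidates, the larger would lie in the interval free of E
      that follows the smaller.\<close>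
    have "\<not> \<delta> < \<delta>0" using \<delta>(4) \<delta>0(1,2) \<open>\<zeta> < x\<close> by fastforce
    moreover have "\<not> \<delta>0 < \<delta>" using \<delta>0(3) \<delta>(1,2) x0 by fastforce
    ultimately show "x \<in> F \<delta>0" using \<delta>(3) by (metis neqE)
  qed
  then show False using inf fin finite_subset by blast
qed

lemma club_in_fill:
  assumes fin: "\<And>\<delta>. finite (F \<delta>)" and E: "club_in E {..<\<alpha>}"
  shows "club_in (fill \<alpha> E F) {..<\<alpha>}"
  unfolding club_in_iff
proof
  show "cofinal_in (fill \<alpha> E F) {..<\<alpha>}"
    using E unfolding club_in_iff cofinal_in_def fill_def by blast
  show "\<forall>\<beta>\<in>{..<\<alpha>}. limit_of (fill \<alpha> E F) \<beta> \<and> {..<\<beta>} \<noteq> {} \<longrightarrow> \<beta> \<in> fill \<alpha> E F"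
    using limit_of_fill[of F \<alpha> E, OF fin] E unfolding club_in_iff fill_def by blast
qed

text \<open>Once everything below \<delta> is removed, \<delta> has index 0 and the uninterrupted
  block \<open>F \<delta>\<close> occupies the next indices, which are those that
  \<open>succ_n\<close> collects.\<close>

lemma succ_n_fill:
  assumes \<delta>: "\<delta> \<in> E" and F: "finite (F \<delta>)" "F \<delta> \<subseteq> {\<delta><..<\<alpha>}"
    and above: "\<And>e x. e \<in> E \<Longrightarrow> \<delta> < e \<Longrightarrow> x \<in> F \<delta> \<Longrightarrow> x < e"
  shows "succ_n (card (F \<delta>)) (fill \<alpha> E F - {..<\<delta>}) \<subseteq> F \<delta>"
proof -
  let ?X = "fill \<alpha> E F - {..<\<delta>}"
  have \<delta>X: "\<delta> \<in> ?X" using \<delta> unfolding fill_def by auto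
  have least: "(LEAST x. x \<in> ?X) = \<delta>"
    by (rule Least_equality) (use \<delta>X in auto)
  have sub: "F \<delta> \<subseteq> ?X - {\<delta>}"
  proof
    fix x assume x: "x \<in> F \<delta>"
    then have "{\<delta><..x} \<inter> E = {}" using above by fastforce
    moreover have "\<delta> < x" "x < \<alpha>" using x F(2) by auto
    ultimately show "x \<in> ?X - {\<delta>}" using x \<delta> unfolding fill_def by auto
  qed
  have rest: "f < y" if y: "y \<in> ?X - {\<delta>} - F \<delta>" and f: "f \<in> F \<delta>" for y f
  proof -
    have \<delta>y: "\<delta> < y" and yF: "y \<notin> F \<delta>" using y by auto
    show ?thesis
    proof (cases "y \<in> E")
      case True
      then show ?thesis using above \<delta>y f by blast
    next
      case False
      \<comment> \<open>An inserted point outside \<open>F \<delta>\<close> belongs to the block of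
        a later e in E, and e already exceeds the block of \<delta>.\<close>
      then obtain e where e: "e \<in> E" "e < y" "y \<in> F e" "{e<..y} \<inter> E = {}"
        using y unfolding fill_def by blast
      have "\<not> e < \<delta>" using e(4) \<delta> \<delta>y by fastforce
      moreover have "e \<noteq> \<delta>" using e(3) yF by blast
      ultimately have "\<delta> < e" by auto
      then have "f < e" using above e(1) f by blast
      then show ?thesis using e(2) by (rule order.strict_trans)
    qed
  qed
  have "enumerate (?X - {\<delta>}) j \<in> F \<delta>" if "j < card (F \<delta>)" for j
    using enumerate_in_initial_part[OF F(1) sub rest that] by blast
  then have "enumerate ?X (j + 1) \<in> F \<delta>" if "j < card (F \<delta>)" for j
    using that unfolding Suc_eq_plus1[symmetric] enumerate_Suc least by blast
  then show ?thesis unfolding succ_n_def by blast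
qed

section \<open>Truncating clubs, and clubs avoiding a nonreflecting set\<close>

lemma limit_of_imp_osup:
  assumes "C \<subseteq> {..<\<alpha>}" "limit_of C \<alpha>"
  shows "osup C = {..<\<alpha>}"
  using assms osup_Int_lessThan_iff[of C \<alpha>] by (simp add: Int_absorb2)

lemma countably_closed_lessThan_limit: "countably_closed {..<\<alpha>} \<Longrightarrow> limit_of UNIV \<alpha>"
  using cofinal_in_above[of "{..<\<alpha>}" "{..<\<alpha>}"] unfolding limit_of_def cofinal_in_def
  by (metis UNIV_I lessThan_iff order_refl)

text \<open>For coherence: truncation at an accumulation point leaves a club and adds no
  accumulation points, so avoidance of S is inherited.\<close>

lemma club_in_Int_lessThan:
  assumes C: "club_in C {..<\<alpha>}" and \<beta>: "\<beta> \<in> acc C"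
  shows "club_in (C \<inter> {..<\<beta>}) {..<\<beta>}" "acc (C \<inter> {..<\<beta>}) \<subseteq> acc C"
proof -
  have l: "limit_of C \<beta>" and \<beta>\<alpha>: "\<beta> < \<alpha>"
    using C \<beta> unfolding acc_iff club_in_iff cofinal_in_def by auto
  show "club_in (C \<inter> {..<\<beta>}) {..<\<beta>}"
    unfolding club_in_iff
  proof
    show "cofinal_in (C \<inter> {..<\<beta>}) {..<\<beta>}"
      using l unfolding limit_of_def cofinal_in_def by (auto intro: less_imp_le)
    show "\<forall>\<gamma>\<in>{..<\<beta>}. limit_of (C \<inter> {..<\<beta>}) \<gamma> \<and> {..<\<gamma>} \<noteq> {} \<longrightarrow> \<gamma> \<in> C \<inter> {..<\<beta>}"
    proof (intro ballI impI)
      fix \<gamma> assume \<gamma>: "\<gamma> \<in> {..<\<beta>}" "limit_of (C \<inter> {..<\<beta>}) \<gamma> \<and> {..<\<gamma>} \<noteq> {}"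
      have "limit_of C \<gamma>" by (rule limit_of_mono[of "C \<inter> {..<\<beta>}"]) (use \<gamma> in auto)
      moreover have "\<gamma> < \<alpha>" using \<gamma> \<beta>\<alpha> by auto
      ultimately show "\<gamma> \<in> C \<inter> {..<\<beta>}" using C \<gamma> unfolding club_in_iff by blast
    qed
  qed
  show "acc (C \<inter> {..<\<beta>}) \<subseteq> acc C"
    using limit_of_mono[of "C \<inter> {..<\<beta>}" _ C] unfolding acc_iff subset_iff by blast
qed

text \<open>In uncountable cofinality, nonreflection yields a club disjoint from S; otherwise a club
  without accumulation points suffices. Full disjointness is needed for the sets
  \<open>E \<alpha>\<close> with \<alpha> in S.\<close>

lemma club_avoiding_nonreflecting:
  assumes si: "strongly_inaccessible (otp (UNIV :: 'k::wellorder set))"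
    and S: "nonreflecting S" and \<alpha>: "limit_of UNIV \<alpha>" "{..<\<alpha>::'k} \<noteq> {}"
  obtains C where "club_in C {..<\<alpha>}" "acc C \<inter> S = {}" "omega < cf \<alpha> \<longrightarrow> C \<inter> S = {}"
proof (cases "omega < cf \<alpha>")
  case True
  then have "\<not> stationary_in (S \<inter> {..<\<alpha>}) {..<\<alpha>}" using S unfolding nonreflecting_def by blast
  then obtain C where C: "club_in C {..<\<alpha>}" "S \<inter> {..<\<alpha>} \<inter> C = {}"
    unfolding stationary_in_def by blast
  then have "C \<inter> S = {}" unfolding club_in_iff cofinal_in_def by blast
  moreover then have "acc C \<inter> S = {}" unfolding acc_def by blast
  ultimately show ?thesis using that C by blast
next
  case False
  obtain X where "countable X" "cofinal_in X {..<\<alpha>}" using countable_cofinal_of_cf[OF si False] .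
  then obtain C where C: "club_in C {..<\<alpha>}" "\<And>\<beta>. \<beta> < \<alpha> \<Longrightarrow> {..<\<beta>} \<noteq> {} \<Longrightarrow> \<not> limit_of C \<beta>"
    using club_without_limits[OF _ _ \<alpha>(2)] by blast
  then have "acc C = {}" unfolding set_eq_iff acc_iff club_in_iff cofinal_in_def by blast
  then show ?thesis using that C False by blast
qed

section \<open>Construction of the sequence, coherence and guessing\<close>

theorem theorem4p28:
  fixes S :: "'k::wellorder set" and A :: "'k \<Rightarrow> 'k set"
  assumes "strongly_inaccessible (otp (UNIV :: 'k set))"
    and "stationary_in S UNIV" and "nonreflecting S"
    and "S \<subseteq> {\<alpha>. omega < cf \<alpha>}"
    and "\<And>\<alpha>. \<alpha> \<in> S \<Longrightarrow> cofinal_in (A \<alpha>) {..<\<alpha>}"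
    and "\<And>B. cofinal_in B UNIV \<Longrightarrow>
           \<exists>\<alpha>\<in>S. stationary_in {\<delta>. \<delta> < \<alpha> \<and> (LEAST \<eta>. \<eta> \<in> A \<alpha> - {..\<delta>}) \<in> B} {..<\<alpha>}"
  shows "P_minus S"
proof -
  note si = assms(1)
  have ccU: "countably_closed (UNIV :: 'k set)" using countably_closed_UNIV[OF si] .
  have cc: "countably_closed {..<\<alpha>}" if "\<alpha> \<in> S" for \<alpha>
    by (rule countably_closed_of_cf[OF si]) (use that assms(4) in auto)
  have limS: "limit_of UNIV \<alpha>" "{..<\<alpha>} \<noteq> {}" if "\<alpha> \<in> S" for \<alpha>
    using countably_closed_lessThan_limit[OF cc[OF that]] cc[OF that]
    unfolding countably_closed_def by (auto dest: spec[of _ "{}"])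
  obtain g :: "'k \<Rightarrow> 'k set"
    where fing: "\<And>\<eta>. finite (g \<eta>)" and g: "\<And>F \<epsilon>. finite F \<Longrightarrow> \<exists>\<eta>>\<epsilon>. g \<eta> = F"
    using finite_sets_enumerated_cofinally[OF si] by metis
  define a where "a \<alpha> \<delta> = (LEAST \<eta>. \<eta> \<in> A \<alpha> - {..\<delta>})" for \<alpha> \<delta>
  have a: "a \<alpha> \<delta> \<in> A \<alpha>" "\<delta> < a \<alpha> \<delta>" "a \<alpha> \<delta> < \<alpha>" if \<alpha>: "\<alpha> \<in> S" and \<delta>: "\<delta> < \<alpha>" for \<alpha> \<delta>
  proof -
    obtain x where "x \<in> A \<alpha> - {..\<delta>}"
      using limit_of_cofinal[OF assms(5)[OF \<alpha>] limS(1)[OF \<alpha>]] \<delta>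
      unfolding limit_of_def by force
    then have "a \<alpha> \<delta> \<in> A \<alpha> - {..\<delta>}" unfolding a_def by (rule LeastI)
    then show "a \<alpha> \<delta> \<in> A \<alpha>" "\<delta> < a \<alpha> \<delta>" "a \<alpha> \<delta> < \<alpha>"
      using assms(5)[OF \<alpha>] unfolding cofinal_in_def by auto
  qed
  \<comment> \<open>Applied to later points e of \<open>E \<alpha>\<close>, this keeps the code
    attached to \<delta>, and with it a block lying below its code, below e.\<close>
  have a_less: "a \<alpha> \<delta> < e" if e: "limit_of (A \<alpha>) e" "\<delta> < e" for \<alpha> \<delta> e
  proof -
    obtain x where x: "x \<in> A \<alpha> - {..\<delta>}" "x < e" using e unfolding limit_of_def by force
    have "a \<alpha> \<delta> \<le> x" unfolding a_def using x(1) by (rule Least_le)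
    then show ?thesis using x(2) by simp
  qed
  have "\<exists>E. club_in E {..<\<alpha>} \<and> E \<inter> S = {} \<and> (\<forall>e\<in>E. limit_of (A \<alpha>) e)" if \<alpha>: "\<alpha> \<in> S" for \<alpha>
  proof -
    obtain C where C: "club_in C {..<\<alpha>}" "acc C \<inter> S = {}" "omega < cf \<alpha> \<longrightarrow> C \<inter> S = {}"
      by (rule club_avoiding_nonreflecting[OF si assms(3) limS[OF \<alpha>]])
    have CS: "C \<inter> S = {}" using C(3) assms(4) \<alpha> by auto
    have "club_in (C \<inter> {\<beta>\<in>{..<\<alpha>}. limit_of (A \<alpha>) \<beta>}) {..<\<alpha>}"
      by (rule club_in_Int[OF cc[OF \<alpha>] C(1) club_in_limits[OF cc[OF \<alpha>] assms(5)[OF \<alpha>]]])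
    then show ?thesis using CS by blast
  qed
  then obtain E where E: "\<And>\<alpha>. \<alpha> \<in> S \<Longrightarrow> club_in (E \<alpha>) {..<\<alpha>}"
      and ES: "\<And>\<alpha>. \<alpha> \<in> S \<Longrightarrow> E \<alpha> \<inter> S = {}"
      and EA: "\<And>\<alpha> e. \<alpha> \<in> S \<Longrightarrow> e \<in> E \<alpha> \<Longrightarrow> limit_of (A \<alpha>) e"
    by metis
  define F where "F \<alpha> \<delta> = g (a \<alpha> \<delta>)" for \<alpha> \<delta>
  define \<C> where "\<C> \<alpha> = (if \<alpha> \<in> S then {fill \<alpha> (E \<alpha>) (F \<alpha>)}
      else {C. club_in C {..<\<alpha>} \<and> acc C \<inter> S = {}})" for \<alpha>
  have finF: "finite (F \<alpha> \<delta>)" for \<alpha> \<delta> by (simp add: F_def fing)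
  have \<C>: "club_in C {..<\<alpha>} \<and> acc C \<inter> S = {}" if C: "C \<in> \<C> \<alpha>" for C \<alpha>
  proof (cases "\<alpha> \<in> S")
    case True
    then have C: "C = fill \<alpha> (E \<alpha>) (F \<alpha>)" using C by (simp add: \<C>_def)
    have club: "club_in C {..<\<alpha>}" unfolding C by (rule club_in_fill[OF finF E[OF True]])
    \<comment> \<open>Accumulation points of the filled club are limits of
      \<open>E \<alpha>\<close>, hence members of it, and \<open>E \<alpha>\<close> misses
      S.\<close>
    have "\<beta> \<in> E \<alpha>" if "\<beta> \<in> acc C" for \<beta>
    proof -
      have "\<beta> < \<alpha>" "limit_of C \<beta>" "{..<\<beta>} \<noteq> {}"
        using that club unfolding acc_iff club_in_iff cofinal_in_def by auto
      moreover from this have "limit_of (E \<alpha>) \<beta>" using limit_of_fill[of "F \<alpha>", OF finF] C by blast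
      ultimately show ?thesis using E[OF True] unfolding club_in_iff by blast
    qed
    then show ?thesis using club ES[OF True] by blast
  next
    case False
    then show ?thesis using C by (simp add: \<C>_def)
  qed
  have osup\<C>: "osup C = {..<\<alpha>}" if "club_in C {..<\<alpha>}" "limit_of UNIV \<alpha>" for C \<alpha>
    using that limit_of_cofinal limit_of_imp_osup unfolding club_in_iff
    by (metis cofinal_in_def)
  have part1: "\<C> \<alpha> \<subseteq> {C \<in> K_set. osup C = {..<\<alpha>}} \<and>
           \<C> \<alpha> \<noteq> {} \<and> |\<C> \<alpha>| <o otp (UNIV :: 'k set) \<and>
           (\<forall>C \<in> \<C> \<alpha>. \<forall>\<beta> \<in> acc C. \<exists>D \<in> \<C> \<beta>. S_end_ext S D C)"
    if "\<alpha> \<in> acc UNIV" for \<alpha>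
  proof (intro conjI)
    have lim: "limit_of UNIV \<alpha>" and ne: "{..<\<alpha>} \<noteq> {}" using that unfolding acc_iff by auto
    show "\<C> \<alpha> \<subseteq> {C \<in> K_set. osup C = {..<\<alpha>}}"
    proof
      fix C assume "C \<in> \<C> \<alpha>"
      then have C: "club_in C {..<\<alpha>}" using \<C> by blast
      then have sub: "C \<subseteq> {..<\<alpha>}" "C \<noteq> {}"
        using ne unfolding club_in_iff cofinal_in_def by blast+
      have o: "osup C = {..<\<alpha>}" using osup\<C>[OF C lim] .
      have "{..<\<alpha>} \<notin> lessThan ` C" using sub(1) by auto
      then show "C \<in> {C \<in> K_set. osup C = {..<\<alpha>}}" unfolding K_set_def using o C sub by simp
    qed
    show "\<C> \<alpha> \<noteq> {}"
    proof (cases "\<alpha> \<in> S")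
      case False
      obtain C where "club_in C {..<\<alpha>}" "acc C \<inter> S = {}" "omega < cf \<alpha> \<longrightarrow> C \<inter> S = {}"
        by (rule club_avoiding_nonreflecting[OF si assms(3) lim ne])
      then show ?thesis using False unfolding \<C>_def by auto
    qed (simp add: \<C>_def)
    have "\<C> \<alpha> \<subseteq> Pow {..<\<alpha>}" using \<C> unfolding club_in_iff cofinal_in_def by blast
    then have "|\<C> \<alpha>| \<le>o |Pow {..<\<alpha>}|" by (rule card_of_mono1)
    moreover have "|Pow {..<\<alpha>}| <o otp (UNIV :: 'k set)"
      using si strongly_inaccessible_lessThan[OF si] unfolding strongly_inaccessible_def by simp
    ultimately show "|\<C> \<alpha>| <o otp (UNIV :: 'k set)" by (rule ordLeq_ordLess_trans)
    show "\<forall>C \<in> \<C> \<alpha>. \<forall>\<beta> \<in> acc C. \<exists>D \<in> \<C> \<beta>. S_end_ext S D C"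
    proof (intro ballI)
      fix C \<beta> assume C: "C \<in> \<C> \<alpha>" and \<beta>: "\<beta> \<in> acc C"
      \<comment> \<open>Thus \<open>\<C> \<beta>\<close> contains all clubs in \<beta> avoiding S at
        accumulation points, in particular the truncation of C. This is also the second half of
        \<open>S_end_ext\<close>.\<close>
      have \<beta>S: "\<beta> \<notin> S" using \<C>[OF C] \<beta> by blast
      let ?D = "C \<inter> {..<\<beta>}"
      have cl: "club_in C {..<\<alpha>}" using \<C>[OF C] by blast
      have "?D \<in> \<C> \<beta>"
        using club_in_Int_lessThan[OF cl \<beta>] \<C>[OF C] \<beta>S unfolding \<C>_def by auto
      moreover have "osup ?D = {..<\<beta>}" using \<beta> unfolding acc_def by simp
      then have "S_end_ext S ?D C" unfolding S_end_ext_def using \<beta>S by auto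
      ultimately show "\<exists>D \<in> \<C> \<beta>. S_end_ext S D C" by blast
    qed
  qed
  have part2: "\<exists>\<alpha>\<in>S. \<alpha> \<in> K \<and>
      osup {\<gamma> \<in> fill \<alpha> (E \<alpha>) (F \<alpha>). succ_n n (fill \<alpha> (E \<alpha>) (F \<alpha>) - {..<\<gamma>}) \<subseteq> B} = {..<\<alpha>}"
    if B: "cofinal_in B UNIV" and K: "club_in K UNIV" for B K n
  proof -
    \<comment> \<open>The point e of K makes every nonzero closure point of h a limit of K. The
      block lies between \<epsilon> and its own code \<eta>.\<close>
    let ?P = "\<lambda>\<epsilon> \<eta>. (\<exists>e\<in>K. \<epsilon> < e \<and> e < \<eta>) \<and> g \<eta> \<subseteq> B \<inter> {\<epsilon><..<\<eta>} \<and> card (g \<eta>) = n"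
    have exP: "\<exists>\<eta>. ?P \<epsilon> \<eta>" for \<epsilon>
    proof -
      obtain e where e: "e \<in> K" "\<epsilon> < e"
        using cofinal_in_above[OF ccU, of K \<epsilon>] K unfolding club_in_iff by auto
      have "infinite (B \<inter> {\<epsilon><..})"
      proof
        assume "finite (B \<inter> {\<epsilon><..})"
        then obtain b where b: "\<forall>x\<in>insert \<epsilon> (B \<inter> {\<epsilon><..}). x < b"
          using ccU unfolding countably_closed_def by (meson countable_finite finite_insert subset_UNIV)
        then obtain x where "x \<in> B" "b \<le> x" using B unfolding cofinal_in_def by blast
        with b show False by (metis Int_iff greaterThan_iff insert_iff leD less_le_trans)
      qed
      then obtain X where X: "X \<subseteq> B \<inter> {\<epsilon><..}" "finite X" "card X = n"
        using infinite_arbitrarily_large by blast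
      obtain m where m: "\<forall>x\<in>insert e X. x < m"
        using ccU X(2) unfolding countably_closed_def by (meson countable_finite finite_insert subset_UNIV)
      \<comment> \<open>Codes of X occur cofinally, so one can be found beyond both X and e.\<close>
      obtain \<eta> where "m < \<eta>" "g \<eta> = X" using g[OF X(2)] by blast
      moreover have "x < \<eta>" if "x \<in> insert e X" for x using m that \<open>m < \<eta>\<close> by fastforce
      ultimately have "?P \<epsilon> \<eta>" using e X by (auto intro!: bexI[of _ e])
      then show ?thesis by blast
    qed
    define h where "h \<epsilon> = (SOME \<eta>. ?P \<epsilon> \<eta>)" for \<epsilon>
    have h: "?P \<epsilon> (h \<epsilon>)" for \<epsilon> unfolding h_def by (rule someI_ex[OF exP])
    have h_gt: "\<epsilon> < h \<epsilon>" for \<epsilon> using h[of \<epsilon>] by (meson order.strict_trans)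
    define D where "D = {\<epsilon>. \<forall>\<epsilon>'<\<epsilon>. h \<epsilon>' < \<epsilon>}"
    have D_K: "\<epsilon> \<in> K" if "\<epsilon> \<in> D" "{..<\<epsilon>} \<noteq> {}" for \<epsilon>
    proof -
      have "limit_of K \<epsilon>" unfolding limit_of_def
        using that(1) h unfolding D_def by (metis (no_types, lifting) mem_Collect_eq order.strict_trans)
      then show ?thesis using K that(2) unfolding club_in_iff by blast
    qed
    have D_closed: "\<beta> \<in> D" if lim: "limit_of D \<beta>" for \<beta>
      unfolding D_def
    proof (intro CollectI allI impI)
      fix \<epsilon> assume "\<epsilon> < \<beta>"
      then obtain d where "d \<in> D" "\<epsilon> < d" "d < \<beta>" using lim unfolding limit_of_def by blast
      then show "h \<epsilon> < \<beta>" unfolding D_def by (auto intro: order.strict_trans)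
    qed
    have D_cof: "\<exists>y\<in>D. x < y" for x
    proof -
      have "\<exists>\<beta>. \<forall>y\<in>h ` {..<x}. y < \<beta>" for x
        using strongly_inaccessible_bounded[OF si] card_of_image strongly_inaccessible_lessThan[OF si]
          ordLeq_ordLess_trans by blast
      then obtain b where b: "\<And>x y. y < x \<Longrightarrow> h y < b x" by (metis imageI lessThan_iff)
      \<comment> \<open>The term \<open>b x\<close> bounds h on all smaller arguments, so limits of
        orbits of f are closure points of h; the term \<open>h x\<close> makes f increase its
        argument.\<close>
      define f where "f x = max (b x) (h x)" for x
      have f: "f x \<in> UNIV \<and> x < f x" for x unfolding f_def using h_gt by (simp add: less_max_iff_disj)
      obtain y where y: "x < y" "\<And>\<zeta>. \<zeta> < y \<Longrightarrow> \<exists>z. \<zeta> < z \<and> z \<in> UNIV \<and> f z < y"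
        using countably_closed_orbit_limit[OF ccU f, of x] by blast
      have "h \<epsilon> < y" if "\<epsilon> < y" for \<epsilon>
      proof -
        obtain z where "\<epsilon> < z" "f z < y" using y(2)[OF \<open>\<epsilon> < y\<close>] by blast
        then show ?thesis using b[of \<epsilon> z] unfolding f_def by (auto intro: order.strict_trans)
      qed
      then show ?thesis using y(1) unfolding D_def by blast
    qed
    have "\<exists>\<eta>\<in>h ` D. \<xi> \<le> \<eta>" for \<xi>
      using D_cof[of \<xi>] h_gt by (meson image_eqI less_imp_le order.strict_trans)
    then have "cofinal_in (h ` D) UNIV" unfolding cofinal_in_def by blast
    then obtain \<alpha> where \<alpha>: "\<alpha> \<in> S" and st: "stationary_in {\<delta>. \<delta> < \<alpha> \<and> a \<alpha> \<delta> \<in> h ` D} {..<\<alpha>}"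
      using assms(6) unfolding a_def by blast
    note cc\<alpha> = cc[OF \<alpha>]
    have hits: "\<exists>\<delta>\<in>X. \<xi> < \<delta> \<and> \<delta> < \<alpha> \<and> a \<alpha> \<delta> \<in> h ` D"
      if "club_in X {..<\<alpha>}" "\<xi> < \<alpha>" for X \<xi>
    proof -
      have "club_in (X \<inter> {x\<in>{..<\<alpha>}. \<xi> < x}) {..<\<alpha>}"
        using club_in_Int[OF cc\<alpha> that(1) club_in_greaterThan[OF cc\<alpha>]] that(2) by simp
      then show ?thesis using st unfolding stationary_in_def by blast
    qed
    have clubU: "club_in {..<\<alpha>} {..<\<alpha>}" unfolding club_in_iff cofinal_in_def by auto
    have hB: "\<exists>b\<in>h ` D. \<xi> < b \<and> b < \<alpha>" if "\<xi> < \<alpha>" for \<xi>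
    proof -
      obtain \<delta> where "\<xi> < \<delta>" "\<delta> < \<alpha>" "a \<alpha> \<delta> \<in> h ` D" using hits[OF clubU \<open>\<xi> < \<alpha>\<close>] by blast
      then show ?thesis using a[OF \<alpha>] by (meson order.strict_trans)
    qed
    \<comment> \<open>So far only the values of h on D are known to be unbounded in \<alpha>. If h
      \<epsilon> < h \<epsilon>' are two of them, closure of \<epsilon> forces \<epsilon> <
      \<epsilon>', and closure of \<epsilon>' then puts \<epsilon>' above h \<epsilon>.\<close>
    have limD: "limit_of D \<alpha>" unfolding limit_of_def
    proof (intro allI impI)
      fix \<xi> assume "\<xi> < \<alpha>"
      then obtain \<epsilon> where \<epsilon>: "\<epsilon> \<in> D" "\<xi> < h \<epsilon>" "h \<epsilon> < \<alpha>" using hB by blast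
      then obtain \<epsilon>' where \<epsilon>': "\<epsilon>' \<in> D" "h \<epsilon> < h \<epsilon>'" "h \<epsilon>' < \<alpha>" using hB by blast
      have "\<not> \<epsilon>' < \<epsilon>"
        using \<epsilon>(1) \<epsilon>'(2) h_gt[of \<epsilon>] unfolding D_def by fastforce
      then have "\<epsilon> < \<epsilon>'" using \<epsilon>'(2) by (metis less_irrefl neqE)
      then have "h \<epsilon> < \<epsilon>'" using \<epsilon>'(1) unfolding D_def by blast
      then show "\<exists>x\<in>D. \<xi> < x \<and> x < \<alpha>"
        using \<epsilon> \<epsilon>' h_gt[of \<epsilon>'] by (meson order.strict_trans)
    qed
    then have \<alpha>K: "\<alpha> \<in> K" using D_K[OF D_closed] limS(2)[OF \<alpha>] by blast
    have clubD: "club_in (D \<inter> {..<\<alpha>}) {..<\<alpha>}"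
      unfolding club_in_iff
    proof
      show "cofinal_in (D \<inter> {..<\<alpha>}) {..<\<alpha>}"
        using limD unfolding limit_of_def cofinal_in_def by (auto intro: less_imp_le)
      show "\<forall>\<beta>\<in>{..<\<alpha>}. limit_of (D \<inter> {..<\<alpha>}) \<beta> \<and> {..<\<beta>} \<noteq> {} \<longrightarrow> \<beta> \<in> D \<inter> {..<\<alpha>}"
        using D_closed limit_of_mono[of "D \<inter> {..<\<alpha>}" _ D] by blast
    qed
    let ?C = "fill \<alpha> (E \<alpha>) (F \<alpha>)"
    let ?G = "{\<gamma> \<in> ?C. succ_n n (?C - {..<\<gamma>}) \<subseteq> B}"
    have "limit_of ?G \<alpha>" unfolding limit_of_def
    proof (intro allI impI)
      fix \<xi> assume "\<xi> < \<alpha>"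
      then obtain \<delta> where \<delta>: "\<delta> \<in> E \<alpha>" "\<delta> \<in> D" "\<xi> < \<delta>" "\<delta> < \<alpha>" "a \<alpha> \<delta> \<in> h ` D"
        using hits[OF club_in_Int[OF cc\<alpha> E[OF \<alpha>] clubD]] by blast
      then obtain \<epsilon> where \<epsilon>: "\<epsilon> \<in> D" "a \<alpha> \<delta> = h \<epsilon>" by blast
      \<comment> \<open>Otherwise closure of \<delta> would give h \<epsilon> < \<delta>, whereas h
        \<epsilon> is the code \<open>a \<alpha> \<delta>\<close>, which exceeds \<delta>.\<close>
      have "\<not> \<epsilon> < \<delta>" using \<delta>(2) a(2)[OF \<alpha> \<delta>(4)] \<epsilon>(2) unfolding D_def by fastforce
      then have F: "F \<alpha> \<delta> \<subseteq> B" "F \<alpha> \<delta> \<subseteq> {\<delta><..<a \<alpha> \<delta>}" "card (F \<alpha> \<delta>) = n"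
        using h[of \<epsilon>] unfolding F_def \<epsilon>(2) by fastforce+
      have "F \<alpha> \<delta> \<subseteq> {\<delta><..<\<alpha>}" using F(2) a(3)[OF \<alpha> \<delta>(4)] by fastforce
      moreover have "x < e" if "e \<in> E \<alpha>" "\<delta> < e" "x \<in> F \<alpha> \<delta>" for e x
        using a_less[OF EA[OF \<alpha> that(1)] that(2)] F(2) that(3) by fastforce
      ultimately have "succ_n (card (F \<alpha> \<delta>)) (?C - {..<\<delta>}) \<subseteq> F \<alpha> \<delta>"
        using succ_n_fill[of \<delta> "E \<alpha>" "F \<alpha>" \<alpha>, OF \<delta>(1) finF] by blast
      then have "\<delta> \<in> ?G" using F \<delta>(1) unfolding fill_def by blast
      then show "\<exists>x\<in>?G. \<xi> < x \<and> x < \<alpha>" using \<delta> by blast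
    qed
    moreover have "?G \<subseteq> {..<\<alpha>}"
      using club_in_fill[of "F \<alpha>", OF finF E[OF \<alpha>]] unfolding club_in_iff cofinal_in_def by blast
    ultimately have "osup ?G = {..<\<alpha>}" by (intro limit_of_imp_osup)
    then show ?thesis using \<alpha> \<alpha>K by blast
  qed
  show ?thesis
    unfolding P_minus_def
  proof (intro exI[of _ \<C>] conjI ballI allI impI)
    fix B :: "'k set" and n :: nat assume B: "cofinal_in B UNIV"
    show "stationary_in {\<alpha> \<in> S. card (\<C> \<alpha>) = 1 \<and>
        (\<forall>C \<in> \<C> \<alpha>. osup {\<gamma> \<in> C. succ_n n (C - {..<\<gamma>}) \<subseteq> B} = {..<\<alpha>})} UNIV"
      unfolding stationary_in_def
    proof (intro conjI allI impI)
      fix K :: "'k set" assume "club_in K UNIV"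
      from part2[OF B this, of n] show "{\<alpha> \<in> S. card (\<C> \<alpha>) = 1 \<and>
        (\<forall>C \<in> \<C> \<alpha>. osup {\<gamma> \<in> C. succ_n n (C - {..<\<gamma>}) \<subseteq> B} = {..<\<alpha>})} \<inter> K \<noteq> {}"
        unfolding \<C>_def by fastforce
    qed simp
  qed (use part1 in blast)+
qed

end
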